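(* Let $N\ge 3$ and let the initial ambiguity set $\mathcal P^0\subset\mathbb R^{N-1}$ be a bounded polyhedron containing the true partworth $\mathbf v^*$. Let $\mathcal B^0$ be the minimum enclosing ball of $\mathcal P^0$, with radius $r(\mathcal B^0)$, and let $\mathcal P^k$, $\mathcal P^{k,i}$, $\mathcal B^k$ ($k\ge 0$, $i\in\{1,\dots,N-1\}$) be generated by the coordinate-wise polyhedral method (CPM) described in the context. Then for every $k\ge 0$, $$\mathcal P^{k+1}=\mathcal P^{k,N-1}\subseteq\cdots\subseteq\mathcal P^{k,1}\subseteq\mathcal P^{k}\subseteq\mathcal B^k ,$$ and for every $k\ge 0$, every $i\in\{1,\dots,N-1\}$ and every $\mathbf v\in\mathcal P^{k,i}$, $$\|\mathbf v-\mathbf v^*\|_\infty\le\|\mathbf v-\mathbf v^*\|_2\le\max_{\mathbf v',\mathbf v''\in\mathcal P^{k,i}}\|\mathbf v'-\mathbf v''\|_2\le 2\,r(\mathcal B^0)\left(\sqrt{1-\frac1{N-1}}\right)^{k}.$$ In particular $\mathcal P^k\to\{\mathbf v^*\}$ as $k\to\infty$ (that is, $\sup_{\mathbf v\in\mathcal P^k}\|\mathbf v-\mathbf v^*\|_2\to 0$).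
   Context: The recovery mapping is $R:\mathbb R^{N-1}\to\mathbb R^N$, $R\mathbf y=(\mathbf y,\,1-\mathbf e^\top\mathbf y)$, with $\mathbf e$ the all-ones vector. A decision maker has true utility $u^*(\mathbf x)=(R\mathbf v^* )^\top\mathbf x$ on $\mathbb R^N$ with unknown $\mathbf v^*\in\mathbb R^{N-1}$, and answers comparisons without error. The minimum enclosing ball (MEB) of a bounded set is the closed Euclidean ball of smallest radius containing it. CPM: start from $\mathcal P^0$. For $k=0,1,2,\dots$ (run without a stopping rule): (1) let $\mathcal B^k$ be the MEB of $\mathcal P^k$, with center $\mathbf c^k$ and radius $r(\mathcal B^k)$; (2) choose an arbitrary orthonormal basis $\boldsymbol\alpha^{k,1},\dots,\boldsymbol\alpha^{k,N-1}$ of $\mathbb R^{N-1}$ and put $\mathcal P^{k,0}=\mathcal P^k$; (3) for $i=1,\dots,N-1$: present a query $(\mathbf x^{A},\mathbf x^{B})\in\mathbb R^N\times\mathbb R^N$ with separating hyperplane $\{\mathbf v:(\boldsymbol\alpha^{k,i})^\top(\mathbf v-\mathbf c^k)=0\}$, namely such that for some $\gamma>0$, $x^A_N-x^B_N=-\gamma(\boldsymbol\alpha^{k,i})^\top\mathbf c^k$ and $x^A_j-x^B_j=(x^A_N-x^B_N)+\gamma\alpha^{k,i}_j$ for $j=1,\dots,N-1$ (so that $(R\mathbf v)^\top(\mathbf x^A-\mathbf x^B)=\gamma(\boldsymbol\alpha^{k,i})^\top(\mathbf v-\mathbf c^k)$ for all $\mathbf v$); set $\mu^{k,i}=-1$ if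 $(R\mathbf v^* )^\top\mathbf x^A\ge(R\mathbf v^* )^\top\mathbf x^B$ and $\mu^{k,i}=1$ otherwise; update $$\mathcal P^{k,i}=\mathcal P^{k,i-1}\cap\{\mathbf v\in\mathbb R^{N-1}:\mu^{k,i}(R\mathbf v)^\top(\mathbf x^A-\mathbf x^B)\le 0\};$$ (4) set $\mathcal P^{k+1}=\mathcal P^{k,N-1}$. *)

theory Defs
  imports "HOL-Analysis.Analysis"
begin

text \<open>
  The space of reduced partworths (dimension \<open>N - 1\<close>) is \<open>real ^ 'n\<close> with \<open>CARD('n) = N - 1\<close>.
  The attribute space (dimension \<open>N\<close>) is the Euclidean space \<open>(real ^ 'n) \<times> real\<close>: the first
  component of a pair holds the coordinates \<open>1, \<dots>, N - 1\<close>, the second one the coordinate \<open>N\<close>.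
\<close>

definition recovery :: "real ^ 'n \<Rightarrow> (real ^ 'n) \<times> real" where
  "recovery y = (y, 1 - (\<Sum>j\<in>UNIV. y $ j))"

definition utility :: "real ^ 'n \<Rightarrow> (real ^ 'n) \<times> real \<Rightarrow> real" where
  "utility v x = recovery v \<bullet> x"

definition is_min_enclosing_ball :: "'a::metric_space set \<Rightarrow> 'a \<Rightarrow> real \<Rightarrow> bool" where
  "is_min_enclosing_ball S c r \<longleftrightarrow>
     0 \<le> r \<and> S \<subseteq> cball c r \<and> (\<forall>c' r'. 0 \<le> r' \<and> S \<subseteq> cball c' r' \<longrightarrow> r \<le> r')"

text \<open>The next three are meaningful for nonempty bounded \<open>S\<close> in a Euclidean space, where the
  minimum enclosing ball exists and is unique.\<close>

definition meb_center :: "'a::metric_space set \<Rightarrow> 'a" where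
  "meb_center S = (THE c. \<exists>r. is_min_enclosing_ball S c r)"

definition meb_radius :: "'a::metric_space set \<Rightarrow> real" where
  "meb_radius S = (THE r. \<exists>c. is_min_enclosing_ball S c r)"

definition meb :: "'a::metric_space set \<Rightarrow> 'a set" where
  "meb S = cball (meb_center S) (meb_radius S)"

definition orthonormal_basis :: "(nat \<Rightarrow> real ^ 'n::finite) \<Rightarrow> bool" where
  "orthonormal_basis a \<longleftrightarrow>
     (\<forall>i\<in>{1..CARD('n)}. \<forall>j\<in>{1..CARD('n)}. a i \<bullet> a j = (if i = j then 1 else 0)) \<and>
     span (a ` {1..CARD('n)}) = UNIV"

text \<open>The pair \<open>(xA, xB)\<close> is a query whose separating hyperplane passes through \<open>c\<close> and has
  normal vector \<open>a\<close>.\<close>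

definition separating_query ::
    "real ^ 'n \<Rightarrow> real ^ 'n \<Rightarrow> (real ^ 'n) \<times> real \<Rightarrow> (real ^ 'n) \<times> real \<Rightarrow> bool" where
  "separating_query a c xA xB \<longleftrightarrow>
     (\<exists>\<gamma>>0. snd xA - snd xB = - \<gamma> * (a \<bullet> c) \<and>
            (\<forall>j. fst xA $ j - fst xB $ j = (snd xA - snd xB) + \<gamma> * (a $ j)))"

text \<open>
  A complete (infinite) run of CPM with true partworth \<open>vt\<close> and initial set \<open>P0\<close>:
  \<open>P k\<close> and \<open>Q k i\<close> are the ambiguity sets \<open>P\<^sup>k\<close> and \<open>P\<^sup>k\<^sup>,\<^sup>i\<close>; \<open>a k i\<close>, \<open>xA k i\<close>,
  \<open>xB k i\<close>, \<open>\<mu> k i\<close> are the direction, the two alternatives and the sign of the answer in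
  round \<open>k\<close>, query \<open>i\<close>. Directions and queries are arbitrary subject to the stated constraints;
  values at indices \<open>i\<close> outside \<open>{1..N - 1}\<close> (for \<open>Q\<close>: outside \<open>{0..N - 1}\<close>) play no role.
\<close>

definition cpm_run ::
    "real ^ 'n::finite \<Rightarrow> (real ^ 'n) set \<Rightarrow>
     (nat \<Rightarrow> (real ^ 'n) set) \<Rightarrow> (nat \<Rightarrow> nat \<Rightarrow> (real ^ 'n) set) \<Rightarrow>
     (nat \<Rightarrow> nat \<Rightarrow> real ^ 'n) \<Rightarrow>
     (nat \<Rightarrow> nat \<Rightarrow> (real ^ 'n) \<times> real) \<Rightarrow> (nat \<Rightarrow> nat \<Rightarrow> (real ^ 'n) \<times> real) \<Rightarrow>
     (nat \<Rightarrow> nat \<Rightarrow> real) \<Rightarrow> bool" where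
  "cpm_run vt P0 P Q a xA xB \<mu> \<longleftrightarrow>
     P 0 = P0 \<and>
     (\<forall>k. orthonormal_basis (a k) \<and>
          Q k 0 = P k \<and>
          (\<forall>i\<in>{1..CARD('n)}.
             separating_query (a k i) (meb_center (P k)) (xA k i) (xB k i) \<and>
             \<mu> k i = (if utility vt (xA k i) \<ge> utility vt (xB k i) then -1 else 1) \<and>
             Q k i = Q k (i - 1) \<inter> {v. \<mu> k i * (recovery v \<bullet> (xA k i - xB k i)) \<le> 0}) \<and>
          P (Suc k) = Q k (CARD('n)))"

end

theory Submission
  imports Defs
begin

text \<open>
  Writing \<open>n = N - 1\<close>, a round of \<open>n\<close> queries cuts the enclosing ball, of centre \<open>c\<close> and
  radius \<open>r\<close>, down to its intersection with an orthant with apex \<open>c\<close> spanned by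
  \<open>s\<^sub>i \<alpha>\<^sub>i\<close>. This piece fits into the ball of radius \<open>r \<surd>(1 - 1/n)\<close> about
  \<open>c + (r/n) \<Sum> s\<^sub>i \<alpha>\<^sub>i\<close>, so the radius of the minimum enclosing ball shrinks by the factor
  \<open>\<surd>(1 - 1/n)\<close> per round, and the diameter is at most twice that radius.
\<close>

section \<open>Existence and uniqueness of the minimum enclosing ball\<close>

text \<open>The radius is a continuous function of the pair (centre, radius), so it attains its
  minimum once the enclosing pairs are confined to a compact set.\<close>

lemma min_enclosing_ball_exists:
  fixes S :: "'a::euclidean_space set"
  assumes "bounded S" "S \<noteq> {}"
  shows "\<exists>c r. is_min_enclosing_ball S c r"
proof -
  obtain x0 where x0: "x0 \<in> S" using assms by blast
  obtain R where R: "S \<subseteq> cball x0 R"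
    using \<open>bounded S\<close> bounded_any_center[of S x0] by (auto simp: subset_iff)
  with x0 have R0: "0 \<le> R" by auto
  \<comment> \<open>Confining the pairs loses nothing: an enclosing ball of radius at most
    \<open>R\<close> contains \<open>x0\<close>, so its centre lies in \<open>cball x0 R\<close>,
    and a larger ball cannot beat \<open>(x0, R)\<close>.\<close>
  define K where "K = (cball x0 R \<times> {0..R}) \<inter> (\<Inter>x\<in>S. {p. dist (fst p) x \<le> snd p})"
  have "compact K" unfolding K_def
    by (intro compact_Int_closed compact_Times compact_cball compact_Icc closed_INT ballI
        closed_Collect_le continuous_intros)
  moreover have "(x0, R) \<in> K"
    using R R0 by (auto simp: K_def subset_iff)
  ultimately obtain p where p: "p \<in> K" "\<And>q. q \<in> K \<Longrightarrow> snd p \<le> snd q"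
    using continuous_attains_inf[of K snd] continuous_on_snd[OF continuous_on_id] by blast
  have "is_min_enclosing_ball S (fst p) (snd p)"
    unfolding is_min_enclosing_ball_def
  proof (intro conjI allI impI)
    show "0 \<le> snd p" "S \<subseteq> cball (fst p) (snd p)"
      using p(1) by (auto simp: K_def)
    fix c' r' assume *: "0 \<le> r' \<and> S \<subseteq> cball c' r'"
    show "snd p \<le> r'"
    proof (cases "r' \<le> R")
      case True
      have "dist c' x0 \<le> r'" using * x0 by auto
      hence "(c', r') \<in> K"
        using * True by (auto simp: K_def dist_commute)
      from p(2)[OF this] show ?thesis by simp
    next
      case False
      thus ?thesis using p(1) by (auto simp: K_def)
    qed
  qed
  thus ?thesis by blast
qed

lemma is_min_enclosing_ball_radius_unique:
  assumes "is_min_enclosing_ball S c r" "is_min_enclosing_ball S c' r'"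
  shows "r = r'"
  using assms unfolding is_min_enclosing_ball_def by (meson order_antisym)

text \<open>By the parallelogram law, two enclosing balls of radius \<open>r\<close> with distinct centres can be
  replaced by a smaller one about the midpoint.\<close>

lemma is_min_enclosing_ball_center_unique:
  fixes S :: "'a::real_inner set"
  assumes ne: "S \<noteq> {}"
    and 1: "is_min_enclosing_ball S c r" and 2: "is_min_enclosing_ball S c' r'"
  shows "c = c'"
proof -
  have "r' = r" using is_min_enclosing_ball_radius_unique[OF 2 1] .
  define m where "m = (1/2) *\<^sub>R (c + c')"
  define d where "d = (norm (c - c') / 2)\<^sup>2"
  have le: "(dist m x)\<^sup>2 \<le> r\<^sup>2 - d" if "x \<in> S" for x
  proof -
    have "dist c x \<le> r" "dist c' x \<le> r"
      using 1 2 that \<open>r' = r\<close> by (auto simp: is_min_enclosing_ball_def)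
    hence "(norm (c - x))\<^sup>2 \<le> r\<^sup>2" "(norm (c' - x))\<^sup>2 \<le> r\<^sup>2"
      by (auto simp: dist_norm intro!: power_mono)
    moreover have "(norm (m - x))\<^sup>2 = ((norm (c - x))\<^sup>2 + (norm (c' - x))\<^sup>2) / 2 - d"
      unfolding m_def d_def power_divide power2_norm_eq_inner
      by (simp add: inner_add_left inner_add_right inner_diff_left inner_diff_right
          inner_commute[of c' c] inner_commute[of x c] inner_commute[of x c'] field_simps)
    ultimately show ?thesis by (simp add: dist_norm)
  qed
  \<comment> \<open>A point of \<open>S\<close> forces \<open>r\<^sup>2 - d\<close> to be
    nonnegative, so its square root is an admissible radius.\<close>
  obtain x where "x \<in> S" using ne by blast
  hence d: "0 \<le> r\<^sup>2 - d" using le[of x] by (meson order_trans zero_le_power2)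
  have "S \<subseteq> cball m (sqrt (r\<^sup>2 - d))"
    using le d by (auto simp: real_le_rsqrt)
  hence "r \<le> sqrt (r\<^sup>2 - d)"
    using 1 d by (simp add: is_min_enclosing_ball_def)
  moreover have "0 \<le> r" using 1 by (simp add: is_min_enclosing_ball_def)
  ultimately have "r\<^sup>2 \<le> (sqrt (r\<^sup>2 - d))\<^sup>2" by (rule power_mono)
  hence "r\<^sup>2 \<le> r\<^sup>2 - d" using d by simp
  thus ?thesis by (simp add: d_def)
qed

text \<open>Existence and uniqueness resolve the definite descriptions behind
  \<open>meb_center\<close> and \<open>meb_radius\<close>.\<close>

lemma is_min_enclosing_ball_meb:
  fixes S :: "'a::euclidean_space set"
  assumes "bounded S" "S \<noteq> {}"
  shows "is_min_enclosing_ball S (meb_center S) (meb_radius S)"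
proof -
  obtain c r where cr: "is_min_enclosing_ball S c r"
    using min_enclosing_ball_exists[OF assms] by blast
  have "meb_center S = c" unfolding meb_center_def
    using cr is_min_enclosing_ball_center_unique[OF assms(2)] by blast
  moreover have "meb_radius S = r" unfolding meb_radius_def
    using cr is_min_enclosing_ball_radius_unique by blast
  ultimately show ?thesis using cr by simp
qed

section \<open>A ball cut by an orthant\<close>

text \<open>The triangle inequality for the expansion of \<open>z\<close> in an orthonormal basis:
  the 2-norm is at most the 1-norm of the coordinates.\<close>

lemma norm_le_sum_abs_inner_orthonormal:
  fixes a :: "'i \<Rightarrow> 'a::euclidean_space"
  assumes fin: "finite I"
    and orth: "\<And>i j. i \<in> I \<Longrightarrow> j \<in> I \<Longrightarrow> a i \<bullet> a j = (if i = j then 1 else 0)"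
    and span: "span (a ` I) = UNIV"
  shows "norm z \<le> (\<Sum>i\<in>I. \<bar>a i \<bullet> z\<bar>)"
proof -
  define w where "w = z - (\<Sum>i\<in>I. (a i \<bullet> z) *\<^sub>R a i)"
  \<comment> \<open>The residual \<open>w\<close> is orthogonal to a spanning set, hence to itself,
    so it vanishes.\<close>
  have "orthogonal w (a j)" if "j \<in> I" for j
    using that fin
    by (simp add: w_def orthogonal_def inner_diff_left inner_sum_left orth inner_commute[of z]
        if_distrib cong: if_cong)
  hence "orthogonal w w"
    by (intro orthogonal_to_span[of w "a ` I"]) (auto simp: span)
  hence "z = (\<Sum>i\<in>I. (a i \<bullet> z) *\<^sub>R a i)" by (simp add: w_def orthogonal_def)
  hence "norm z = norm (\<Sum>i\<in>I. (a i \<bullet> z) *\<^sub>R a i)" by simp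
  also have "\<dots> \<le> (\<Sum>i\<in>I. norm ((a i \<bullet> z) *\<^sub>R a i))" by (rule norm_sum)
  also have "\<dots> = (\<Sum>i\<in>I. \<bar>a i \<bullet> z\<bar>)"
    by (intro sum.cong) (auto simp: norm_eq_sqrt_inner orth)
  finally show ?thesis .
qed

lemma cball_Int_orthant_subset_cball:
  fixes a :: "'i \<Rightarrow> 'a::euclidean_space"
  assumes card: "2 \<le> card I"
    and orth: "\<And>i j. i \<in> I \<Longrightarrow> j \<in> I \<Longrightarrow> a i \<bullet> a j = (if i = j then 1 else 0)"
    and span: "span (a ` I) = UNIV"
    and s: "\<And>i. i \<in> I \<Longrightarrow> \<bar>s i\<bar> = 1"
  shows "cball c r \<inter> {v. \<forall>i\<in>I. 0 \<le> s i * (a i \<bullet> (v - c))} \<subseteq>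
    cball (c + (r / card I) *\<^sub>R (\<Sum>i\<in>I. s i *\<^sub>R a i)) (r * sqrt (1 - 1 / card I))"
proof
  fix v assume v: "v \<in> cball c r \<inter> {v. \<forall>i\<in>I. 0 \<le> s i * (a i \<bullet> (v - c))}"
  define n where "n = real (card I)"
  \<comment> \<open>This \<open>t\<close> minimises
    \<open>r\<^sup>2 - 2 * t * r + t\<^sup>2 * n\<close>, the bound reached below.\<close>
  define t where "t = r / n"
  define z where "z = v - c"
  define e where "e = (\<Sum>i\<in>I. s i *\<^sub>R a i)"
  have fin: "finite I" using card by (intro card_ge_0_finite) auto
  have n: "2 \<le> n" using card by (simp add: n_def)
  have zr: "norm z \<le> r" using v by (simp add: z_def dist_norm norm_minus_commute)
  hence r: "0 \<le> r" using norm_ge_zero order_trans by blast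
  have "s i * s i = 1" if "i \<in> I" for i
    using s[OF that] by (auto simp: abs_if split: if_splits)
  hence ee: "e \<bullet> e = n" using fin
    by (simp add: e_def n_def inner_sum_left inner_sum_right orth if_distrib cong: if_cong)
  have "norm z \<le> (\<Sum>i\<in>I. \<bar>a i \<bullet> z\<bar>)"
    by (rule norm_le_sum_abs_inner_orthonormal[OF fin orth span])
  \<comment> \<open>On the orthant the 1-norm is linear: it is the inner product with
    \<open>e\<close>.\<close>
  also have "\<dots> = (\<Sum>i\<in>I. s i * (a i \<bullet> z))"
  proof (intro sum.cong refl)
    fix i assume i: "i \<in> I"
    have "0 \<le> s i * (a i \<bullet> z)" using v i by (auto simp: z_def)
    thus "\<bar>a i \<bullet> z\<bar> = s i * (a i \<bullet> z)" using s[OF i]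
      by (auto simp: abs_if split: if_splits)
  qed
  also have "\<dots> = e \<bullet> z" by (simp add: e_def inner_sum_left)
  finally have ez: "norm z \<le> e \<bullet> z" .
  have "(norm (z - t *\<^sub>R e))\<^sup>2 = (norm z)\<^sup>2 - 2 * t * (e \<bullet> z) + t\<^sup>2 * n"
    unfolding power2_norm_eq_inner using ee
    by (simp add: inner_diff_left inner_diff_right inner_commute[of z e] algebra_simps power2_eq_square)
  also have "\<dots> \<le> (norm z)\<^sup>2 - 2 * t * norm z + t\<^sup>2 * n"
    using ez r n by (simp add: t_def mult_left_mono divide_right_mono)
  \<comment> \<open>The quadratic in \<open>norm z\<close> is largest on the interval from 0 to
    \<open>r\<close> at \<open>r\<close>: the difference of the two sides factors, and the second
    factor is nonnegative because \<open>2 \<le> n\<close>.\<close>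
  also have "\<dots> \<le> r\<^sup>2 - 2 * t * r + t\<^sup>2 * n"
  proof -
    have "2 * t \<le> r" using r n mult_left_mono[of 2 n r] by (simp add: t_def field_simps)
    hence "0 \<le> (r - norm z) * (r + norm z - 2 * t)"
      using zr by (intro mult_nonneg_nonneg) (auto simp: add_increasing2)
    thus ?thesis by (simp add: algebra_simps power2_eq_square)
  qed
  also have "\<dots> = r\<^sup>2 * (1 - 1 / n)"
    using n by (simp add: t_def field_simps power2_eq_square)
  also have "\<dots> = (r * sqrt (1 - 1 / n))\<^sup>2"
    using n by (simp add: power_mult_distrib)
  finally have "norm (z - t *\<^sub>R e) \<le> r * sqrt (1 - 1 / n)"
    by (rule power2_le_imp_le) (use r n in auto)
  thus "v \<in> cball (c + (r / card I) *\<^sub>R (\<Sum>i\<in>I. s i *\<^sub>R a i)) (r * sqrt (1 - 1 / card I))"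
    by (simp add: dist_norm norm_minus_commute[of _ v] diff_diff_eq z_def t_def n_def e_def)
qed

section \<open>Queries as half-space cuts\<close>

text \<open>The last coordinate of \<open>recovery v\<close> is one minus the coordinate sum of
  \<open>v\<close>; its product with \<open>snd xA - snd xB\<close> cancels the constant shift in
  the other coordinates.\<close>

lemma separating_query_inner:
  assumes "separating_query a c xA xB"
  obtains \<gamma> where "0 < \<gamma>" "\<And>v. recovery v \<bullet> (xA - xB) = \<gamma> * (a \<bullet> (v - c))"
proof -
  obtain \<gamma> where "0 < \<gamma>" and d: "snd xA - snd xB = - \<gamma> * (a \<bullet> c)"
    and *: "\<And>j. fst xA $ j - fst xB $ j = (snd xA - snd xB) + \<gamma> * (a $ j)"
    using assms unfolding separating_query_def by blast
  have "recovery v \<bullet> (xA - xB) = \<gamma> * (a \<bullet> (v - c))" for v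
  proof -
    have "v \<bullet> (fst xA - fst xB) = (\<Sum>j\<in>UNIV. v $ j * ((snd xA - snd xB) + \<gamma> * (a $ j)))"
      by (simp add: inner_vec_def flip: *)
    also have "\<dots> = (snd xA - snd xB) * (\<Sum>j\<in>UNIV. v $ j) + \<gamma> * (a \<bullet> v)"
      by (simp add: inner_vec_def distrib_left sum.distrib sum_distrib_left sum_distrib_right mult_ac)
    finally show ?thesis
      by (simp add: recovery_def inner_prod_def d inner_diff_right algebra_simps)
  qed
  thus thesis using that \<open>0 < \<gamma>\<close> by blast
qed

section \<open>The ambiguity sets of a run\<close>

context
  fixes vt :: "real ^ 'n::finite" and P0 P Q a xA xB \<mu>
  assumes run: "cpm_run vt P0 P Q a xA xB \<mu>"
    and dim: "2 \<le> CARD('n)"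
    and P0: "compact P0" "vt \<in> P0"
begin

text \<open>The positive factor \<open>\<gamma>\<close> drops out of the update, leaving a
  half-space through the centre. The sign \<open>- \<mu> k i\<close> plays the part of
  \<open>s i\<close> in the orthant.\<close>

lemma cpm_cut:
  assumes i: "i \<in> {1..CARD('n)}"
  shows "Q k i = Q k (i - 1) \<inter> {v. 0 \<le> - \<mu> k i * (a k i \<bullet> (v - meb_center (P k)))}"
    and "0 \<le> - \<mu> k i * (a k i \<bullet> (vt - meb_center (P k)))"
    and "\<bar>- \<mu> k i\<bar> = 1"
proof -
  have sq: "separating_query (a k i) (meb_center (P k)) (xA k i) (xB k i)"
    and \<mu>: "\<mu> k i = (if utility vt (xA k i) \<ge> utility vt (xB k i) then -1 else 1)"
    and Q: "Q k i = Q k (i - 1) \<inter> {v. \<mu> k i * (recovery v \<bullet> (xA k i - xB k i)) \<le> 0}"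
    using run i unfolding cpm_run_def by blast+
  obtain \<gamma> where \<gamma>: "0 < \<gamma>"
    "\<And>v. recovery v \<bullet> (xA k i - xB k i) = \<gamma> * (a k i \<bullet> (v - meb_center (P k)))"
    using separating_query_inner[OF sq] by blast
  have iff: "\<mu> k i * (recovery v \<bullet> (xA k i - xB k i)) \<le> 0 \<longleftrightarrow>
      0 \<le> - \<mu> k i * (a k i \<bullet> (v - meb_center (P k)))" for v
  proof -
    have "\<mu> k i * (recovery v \<bullet> (xA k i - xB k i)) =
        \<gamma> * (\<mu> k i * (a k i \<bullet> (v - meb_center (P k))))"
      by (simp add: \<gamma>(2))
    also have "\<dots> \<le> 0 \<longleftrightarrow> \<mu> k i * (a k i \<bullet> (v - meb_center (P k))) \<le> 0"
      using \<gamma>(1) by (simp only: mult_le_0_iff) auto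
    finally show ?thesis by simp
  qed
  show "Q k i = Q k (i - 1) \<inter> {v. 0 \<le> - \<mu> k i * (a k i \<bullet> (v - meb_center (P k)))}"
    using Q iff by simp
  \<comment> \<open>The answer is error-free, so \<open>vt\<close> satisfies the cut it
    induces.\<close>
  have "\<mu> k i * (recovery vt \<bullet> (xA k i - xB k i)) \<le> 0"
    by (simp add: \<mu> utility_def inner_diff_right)
  thus "0 \<le> - \<mu> k i * (a k i \<bullet> (vt - meb_center (P k)))" using iff by simp
  show "\<bar>- \<mu> k i\<bar> = 1" by (simp add: \<mu>)
qed

lemma cpm_run_simps: "P 0 = P0" "Q k 0 = P k" "P (Suc k) = Q k (CARD('n))"
  using run unfolding cpm_run_def by blast+

text \<open>Each cut is a closed half-space containing \<open>vt\<close>. Compactness later makes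
  the diameter attained.\<close>

lemma cpm_Q_compact:
  assumes "compact (P k)" "vt \<in> P k" "i \<le> CARD('n)"
  shows "compact (Q k i) \<and> vt \<in> Q k i"
  using assms(3)
proof (induction i)
  case 0
  thus ?case using assms by (simp add: cpm_run_simps)
next
  case (Suc i)
  hence i: "Suc i \<in> {1..CARD('n)}" by simp
  have "closed {v. 0 \<le> - \<mu> k (Suc i) * (a k (Suc i) \<bullet> (v - meb_center (P k)))}"
    by (intro closed_Collect_le continuous_intros)
  thus ?case
    using Suc cpm_cut(2)[OF i, of k] unfolding cpm_cut(1)[OF i, of k]
    by (auto intro: compact_Int_closed)
qed

lemma cpm_P_compact: "compact (P k) \<and> vt \<in> P k"
proof (induction k)
  case 0
  show ?case using P0 by (simp add: cpm_run_simps)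
next
  case (Suc k)
  thus ?case using cpm_Q_compact[of k "CARD('n)"] by (simp add: cpm_run_simps)
qed

text \<open>All cuts of a round pass through the centre for \<open>P k\<close>, which is not
  recomputed between queries; a full round therefore gives an orthant with that apex.\<close>

lemma cpm_Q_eq:
  "i \<le> CARD('n) \<Longrightarrow>
    Q k i = P k \<inter> {v. \<forall>j\<in>{1..i}. 0 \<le> - \<mu> k j * (a k j \<bullet> (v - meb_center (P k)))}"
proof (induction i)
  case 0
  show ?case by (simp add: cpm_run_simps)
next
  case (Suc i)
  hence i: "Suc i \<in> {1..CARD('n)}" by simp
  show ?case
    unfolding cpm_cut(1)[OF i, of k] using Suc by (auto simp: atLeastAtMostSuc_conv)
qed

section \<open>Decay of radius and diameter\<close>

lemma cpm_is_min_enclosing_ball: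
  "is_min_enclosing_ball (P k) (meb_center (P k)) (meb_radius (P k))"
  using cpm_P_compact[of k] by (intro is_min_enclosing_ball_meb compact_imp_bounded) auto

text \<open>After a full round the remaining set lies in the smaller ball around the orthant piece,
  and minimality bounds the new radius by the radius of that ball.\<close>

lemma cpm_meb_radius_Suc:
  "meb_radius (P (Suc k)) \<le> meb_radius (P k) * sqrt (1 - 1 / CARD('n))"
proof -
  let ?I = "{1..CARD('n)}"
  define c where "c = meb_center (P k)"
  define r where "r = meb_radius (P k)"
  define c' where "c' = c + (r / card ?I) *\<^sub>R (\<Sum>i\<in>?I. (- \<mu> k i) *\<^sub>R a k i)"
  have r: "0 \<le> r" "P k \<subseteq> cball c r"
    using cpm_is_min_enclosing_ball[of k] by (auto simp: is_min_enclosing_ball_def c_def r_def)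
  have on: "orthonormal_basis (a k)" using run unfolding cpm_run_def by blast
  have "P (Suc k) \<subseteq> cball c r \<inter> {v. \<forall>i\<in>?I. 0 \<le> - \<mu> k i * (a k i \<bullet> (v - c))}"
    using cpm_Q_eq[of "CARD('n)" k] r by (auto simp: cpm_run_simps c_def)
  also have "\<dots> \<subseteq> cball c' (r * sqrt (1 - 1 / card ?I))"
    unfolding c'_def
    by (rule cball_Int_orthant_subset_cball)
      (use on dim cpm_cut(3)[of _ k] in \<open>auto simp: orthonormal_basis_def\<close>)
  finally have "P (Suc k) \<subseteq> cball c' (r * sqrt (1 - 1 / CARD('n)))" by simp
  moreover have "0 \<le> r * sqrt (1 - 1 / CARD('n))"
    using r dim by simp
  ultimately show ?thesis
    using cpm_is_min_enclosing_ball[of "Suc k"] unfolding is_min_enclosing_ball_def r_def by blast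
qed

lemma cpm_meb_radius_le:
  "meb_radius (P k) \<le> meb_radius P0 * sqrt (1 - 1 / CARD('n)) ^ k"
proof (induction k)
  case 0
  show ?case by (simp add: cpm_run_simps)
next
  case (Suc k)
  have "0 \<le> sqrt (1 - 1 / CARD('n))" using dim by simp
  from mult_right_mono[OF Suc.IH this] show ?case
    using cpm_meb_radius_Suc[of k] by (simp add: mult_ac)
qed

lemma cpm_P_norm_diff_le:
  assumes "v \<in> P k" "w \<in> P k"
  shows "norm (v - w) \<le> 2 * meb_radius P0 * sqrt (1 - 1 / CARD('n)) ^ k"
proof -
  have "P k \<subseteq> cball (meb_center (P k)) (meb_radius (P k))"
    using cpm_is_min_enclosing_ball[of k] by (simp add: is_min_enclosing_ball_def)
  hence "dist v (meb_center (P k)) \<le> meb_radius (P k)" "dist w (meb_center (P k)) \<le> meb_radius (P k)"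
    using assms by (auto simp: dist_commute)
  hence "dist v w \<le> 2 * meb_radius (P k)"
    using dist_triangle2[of v w "meb_center (P k)"] by simp
  also have "\<dots> \<le> 2 * meb_radius P0 * sqrt (1 - 1 / CARD('n)) ^ k"
    using cpm_meb_radius_le[of k] by simp
  finally show ?thesis by (simp add: dist_norm)
qed

lemma cpm_Q_subset: "i \<le> CARD('n) \<Longrightarrow> Q k i \<subseteq> P k"
  using cpm_Q_eq by blast

text \<open>The witness \<open>m\<close> is the diameter, attained by compactness. The bound is
  inherited from \<open>P k\<close>, hence the exponent \<open>k\<close> throughout the
  round.\<close>

lemma cpm_Q_diameter:
  assumes i: "i \<le> CARD('n)" and v: "v \<in> Q k i"
  shows "\<exists>m. (\<exists>v'\<in>Q k i. \<exists>v''\<in>Q k i. norm (v' - v'') = m) \<and>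
             (\<forall>v'\<in>Q k i. \<forall>v''\<in>Q k i. norm (v' - v'') \<le> m) \<and>
             norm (v - vt) \<le> m \<and>
             m \<le> 2 * meb_radius P0 * sqrt (1 - 1 / CARD('n)) ^ k"
proof -
  have Q: "compact (Q k i)" "vt \<in> Q k i"
    using cpm_Q_compact cpm_P_compact i by blast+
  then obtain p q where pq: "p \<in> Q k i" "q \<in> Q k i"
    and max: "\<forall>u\<in>Q k i. \<forall>w\<in>Q k i. dist u w \<le> dist p q"
    using compact_sup_maxdistance[of "Q k i"] by blast
  show ?thesis
    using pq max v Q(2) cpm_P_norm_diff_le[of p k q] cpm_Q_subset[OF i, of k]
    by (intro exI[of _ "norm (p - q)"]) (auto simp: dist_norm)
qed

lemma cpm_SUP_tendsto_0: "(\<lambda>k. SUP v\<in>P k. norm (v - vt)) \<longlonglongrightarrow> 0"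
proof (rule tendsto_sandwich)
  let ?q = "sqrt (1 - 1 / CARD('n))"
  have le: "norm (v - vt) \<le> 2 * meb_radius P0 * ?q ^ k" if "v \<in> P k" for v k
    using cpm_P_norm_diff_le that cpm_P_compact by blast
  \<comment> \<open>The point \<open>vt\<close> contributes the value 0; a real supremum also
    requires the bound above.\<close>
  have "0 \<le> (SUP v\<in>P k. norm (v - vt))" for k
  proof (rule cSUP_upper2[of _ _ vt])
    show "bdd_above ((\<lambda>v. norm (v - vt)) ` P k)" using le by (auto intro!: bdd_aboveI2)
  qed (use cpm_P_compact in auto)
  thus "\<forall>\<^sub>F k in sequentially. 0 \<le> (SUP v\<in>P k. norm (v - vt))" by simp
  have "(SUP v\<in>P k. norm (v - vt)) \<le> 2 * meb_radius P0 * ?q ^ k" for k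
    using le cpm_P_compact by (intro cSUP_least) auto
  thus "\<forall>\<^sub>F k in sequentially. (SUP v\<in>P k. norm (v - vt)) \<le> 2 * meb_radius P0 * ?q ^ k"
    by simp
  have "?q < 1" "0 \<le> ?q" using dim by simp_all
  thus "(\<lambda>k. 2 * meb_radius P0 * ?q ^ k) \<longlonglongrightarrow> 0"
    by (intro tendsto_mult_right_zero LIMSEQ_realpow_zero)
qed simp

end

theorem theorem3p2:
  fixes N :: nat
    and vt :: "real ^ 'n::finite"
    and P0 :: "(real ^ 'n) set"
    and P :: "nat \<Rightarrow> (real ^ 'n) set"
    and Q :: "nat \<Rightarrow> nat \<Rightarrow> (real ^ 'n) set"
    and a :: "nat \<Rightarrow> nat \<Rightarrow> real ^ 'n"
    and xA xB :: "nat \<Rightarrow> nat \<Rightarrow> (real ^ 'n) \<times> real"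
    and \<mu> :: "nat \<Rightarrow> nat \<Rightarrow> real"
  assumes "N \<ge> 3"
    and "CARD('n) = N - 1"
    and "polyhedron P0"
    and "bounded P0"
    and "vt \<in> P0"
    and "cpm_run vt P0 P Q a xA xB \<mu>"
  shows "(\<forall>k. P (Suc k) = Q k (N - 1) \<and>
              (\<forall>i\<in>{2..N - 1}. Q k i \<subseteq> Q k (i - 1)) \<and>
              Q k 1 \<subseteq> P k \<and>
              P k \<subseteq> meb (P k)) \<and>
         (\<forall>k. \<forall>i\<in>{1..N - 1}. \<forall>v\<in>Q k i.
            infnorm (v - vt) \<le> norm (v - vt) \<and>
            (\<exists>m. (\<exists>v'\<in>Q k i. \<exists>v''\<in>Q k i. norm (v' - v'') = m) \<and>
                 (\<forall>v'\<in>Q k i. \<forall>v''\<in>Q k i. norm (v' - v'') \<le> m) \<and>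
                 norm (v - vt) \<le> m \<and>
                 m \<le> 2 * meb_radius P0 * (sqrt (1 - 1 / (real N - 1))) ^ k)) \<and>
         (\<lambda>k. SUP v\<in>P k. norm (v - vt)) \<longlonglongrightarrow> 0"
proof -
  \<comment> \<open>The statement mixes real and natural subtraction; they agree since
    \<open>N\<close> is positive.\<close>
  have N: "real N - 1 = CARD('n)" "2 \<le> CARD('n)" using assms(1,2) by auto
  have P0: "compact P0"
    using assms(3,4) polyhedron_imp_closed compact_eq_bounded_closed by blast
  note cpm = assms(6) N(2) P0 assms(5)
  show ?thesis
    unfolding N(1) assms(2)[symmetric]
  proof (intro conjI allI ballI)
    fix k
    show "P (Suc k) = Q k CARD('n)" by (rule cpm_run_simps[OF cpm])
    show "Q k i \<subseteq> Q k (i - 1)" if "i \<in> {2..CARD('n)}" for i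
      using that cpm_cut(1)[OF cpm, of i k] by auto
    show "Q k 1 \<subseteq> P k" by (rule cpm_Q_subset[OF cpm]) (use N in simp)
    show "P k \<subseteq> meb (P k)"
      using cpm_is_min_enclosing_ball[OF cpm, of k]
      by (simp add: meb_def is_min_enclosing_ball_def)
  next
    fix k i v assume "i \<in> {1..CARD('n)}" "v \<in> Q k i"
    thus "\<exists>m. (\<exists>v'\<in>Q k i. \<exists>v''\<in>Q k i. norm (v' - v'') = m) \<and>
             (\<forall>v'\<in>Q k i. \<forall>v''\<in>Q k i. norm (v' - v'') \<le> m) \<and>
             norm (v - vt) \<le> m \<and>
             m \<le> 2 * meb_radius P0 * sqrt (1 - 1 / CARD('n)) ^ k"
      by (intro cpm_Q_diameter[OF cpm]) auto
  qed (rule infnorm_le_norm cpm_SUP_tendsto_0[OF cpm])+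
qed

end
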